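(* Let $p,q$ be positive integers with $q\ge 4p+1$, and let $\mathrm{K}_{p,q}$ be the complete bipartite graph with parts of sizes $p$ and $q$. Then $\delta(\mathcal{A}(\mathrm{K}_{p,q}))=2pq$.
   Context: For a connected graph $G=(V,E)$, a search tree on $G$ is a rooted tree with vertex set $V$ defined recursively: its root is some vertex $r\in V$, and $r$ is joined to the roots of search trees on each connected component of $G-r$. The tubes of a search tree are the vertex sets of its subtrees. Two search trees on $G$ are related by a rotation if their sets of tubes have symmetric difference of size exactly two. The graph associahedron $\mathcal{A}(G)$ is a polytope whose skeleton is isomorphic to the graph on search trees of $G$ with adjacency given by rotations; $\delta(\mathcal{A}(G))$ is the diameter of this graph. *)

theory Defs
  imports
    "HOL-Library.FSet"
    "Graph_Theory.Digraph_Component"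
    "Graph_Theory.Shortest_Path"
    "Graph_Theory.Kuratowski"
begin

text \<open>
  As in \<^theory>\<open>Graph_Theory.Digraph\<close>, finite simple graphs are digraphs satisfying the locale
  \<open>graph\<close>; an edge is a pair of opposite arcs. Since such digraphs are symmetric, their strongly
  connected components (as induced subgraphs) are the usual connected components.

  Rooted trees are unordered, with at least one vertex; each vertex is represented by its label.
\<close>

datatype (vertices: 'a) rtree = Node 'a "'a rtree fset"

primrec subtrees :: "'a rtree \<Rightarrow> 'a rtree set" where
  "subtrees (Node r ts) = insert (Node r ts) (\<Union>(fset (subtrees |`| ts)))"

definition tubes :: "'a rtree \<Rightarrow> 'a set set" where
  "tubes T = vertices ` subtrees T"

text \<open>
  The function \<open>f\<close> selects exactly one search tree for each component of \<open>G\<close> minus the root.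
  The recursion ends at the graphs with a single vertex, for which there are no components left.
\<close>

inductive search_tree :: "('a, 'b) pre_digraph \<Rightarrow> 'a rtree \<Rightarrow> bool" where
  Node: "r \<in> verts G \<Longrightarrow>
    (\<And>H. H \<in> pre_digraph.sccs (pre_digraph.del_vert G r) \<Longrightarrow> search_tree H (f H)) \<Longrightarrow>
    fset ts = f ` pre_digraph.sccs (pre_digraph.del_vert G r) \<Longrightarrow>
    search_tree G (Node r ts)"

definition rotation :: "'a rtree \<Rightarrow> 'a rtree \<Rightarrow> bool" where
  "rotation S T \<longleftrightarrow> card ((tubes S - tubes T) \<union> (tubes T - tubes S)) = 2"

text \<open>The skeleton of the graph associahedron of \<open>G\<close>, given by its combinatorial description.\<close>

definition associahedron_graph :: "('a, 'b) pre_digraph \<Rightarrow> 'a rtree pair_pre_digraph" where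
  "associahedron_graph G =
    \<lparr> pverts = {T. search_tree G T},
      parcs = {(S, T). search_tree G S \<and> search_tree G T \<and> rotation S T} \<rparr>"

lemma pair_wf_digraph_associahedron_graph: "pair_wf_digraph (associahedron_graph G)"
  by unfold_locales (auto simp: associahedron_graph_def)

text \<open>Distances are shortest path lengths with unit weights; the distance between vertices not
  joined by a path is infinite, hence the extended reals.\<close>

definition graph_distance :: "('a, 'b) pre_digraph \<Rightarrow> 'a \<Rightarrow> 'a \<Rightarrow> ereal" where
  "graph_distance G u v = wf_digraph.\<mu> G (\<lambda>_. 1) u v"

definition graph_diameter :: "('a, 'b) pre_digraph \<Rightarrow> ereal" where
  "graph_diameter G = (SUP u \<in> verts G. SUP v \<in> verts G. graph_distance G u v)"

definition associahedron_diameter :: "('a, 'b) pre_digraph \<Rightarrow> ereal" where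
  "associahedron_diameter G = graph_diameter (with_proj (associahedron_graph G))"

end

theory Submission
  imports Defs
begin

text \<open>
  As long as both parts of the bipartite graph survive, removing the root leaves a connected graph,
  so a search tree is a chain of vertices whose last vertex exhausts one part; the rest of the other
  part hangs below it as unordered leaves.

  Upper bound: in the tree with all of \<open>B\<close> on top the order of \<open>A\<close> is free, and vice versa. Hence one
  can go from one tree to another by rotations that each exchange an element of \<open>A\<close> with an element
  of \<open>B\<close>, passing through a tree with one part on top and then a tree with the other part on top.
  Choosing which part goes first gives at most \<open>2pq\<close> rotations.

  Lower bound: take two chains starting with \<open>B\<close> in opposite orders. A rotation reverses the order of
  at most one pair of vertices. If \<open>S\<close> is the set of \<open>b \<in> B\<close> that at some time lie below all of \<open>A\<close>,
  then each \<open>b \<in> S\<close> is exchanged twice with each \<open>a \<in> A\<close>. Two elements of \<open>B\<close> that are not both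
  in \<open>S\<close> are comparable throughout, so they are exchanged directly. With \<open>s = |S|\<close> this
  gives at least \<open>2ps + (q - s)(q + s - 1)/2 \<ge> 2pq\<close> rotations.
\<close>

section \<open>Adjacent transpositions of lists\<close>

definition swaps :: "('a list \<times> 'a list) set" where
  "swaps = {(us @ x # y # vs, us @ y # x # vs) | us x y vs. True}"

lemma swapsI: "(us @ x # y # vs, us @ y # x # vs) \<in> swaps"
  by (auto simp: swaps_def)

lemma swaps_set: "(u, v) \<in> swaps \<Longrightarrow> set u = set v \<and> distinct u = distinct v"
  by (auto simp: swaps_def)

lemma swaps_relpow_sym: "(u, v) \<in> swaps ^^ n \<Longrightarrow> (v, u) \<in> swaps ^^ n"
proof (induction n arbitrary: v)
  case (Suc n)
  then obtain w where w: "(u, w) \<in> swaps ^^ n" "(w, v) \<in> swaps" by auto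
  have "(v, w) \<in> swaps" using w(2) by (auto simp: swaps_def)
  with Suc.IH[OF w(1)] show ?case by (blast intro: relpow_Suc_I2)
qed auto

lemma swaps_Cons: "(u, v) \<in> swaps \<Longrightarrow> (z # u, z # v) \<in> swaps"
  unfolding swaps_def by clarsimp (metis append_Cons)

lemma swaps_relpow_Cons: "(u, v) \<in> swaps ^^ n \<Longrightarrow> (z # u, z # v) \<in> swaps ^^ n"
  by (induction n arbitrary: v) (auto intro: swaps_Cons)

lemma swaps_move: "(x # ys @ zs, ys @ x # zs) \<in> swaps ^^ length ys"
proof (induction ys)
  case (Cons y ys)
  have "(x # y # ys @ zs, y # x # ys @ zs) \<in> swaps" using swapsI[of "[]"] by simp
  moreover have "(y # x # ys @ zs, y # ys @ x # zs) \<in> swaps ^^ length ys"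
    using Cons by (rule swaps_relpow_Cons)
  ultimately show ?case by (simp add: relpow_Suc_I2 del: relpow.simps)
qed simp

text \<open>The number of inversions of a word relative to an arrangement with \<open>Y\<close>
  before \<open>X\<close>, hence the cost in adjacent swaps of gathering \<open>Y\<close> in
  front.\<close>

primrec pair_count :: "'a set \<Rightarrow> 'a set \<Rightarrow> 'a list \<Rightarrow> nat" where
  "pair_count X Y [] = 0"
| "pair_count X Y (z # w) =
     (if z \<in> X then length (filter (\<lambda>y. y \<in> Y) w) else 0) + pair_count X Y w"

text \<open>Once the tail is gathered, a head in \<open>X\<close> only has to pass the block of
  \<open>Y\<close>, and a head in \<open>Y\<close> is already in place. Both parts keep their
  internal order.\<close>

lemma swaps_gather:
  assumes "X \<inter> Y = {}" "set w \<subseteq> X \<union> Y"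
  shows "(w, filter (\<lambda>y. y \<in> Y) w @ filter (\<lambda>x. x \<in> X) w) \<in> swaps ^^ pair_count X Y w"
  using assms(2)
proof (induction w)
  case (Cons z w)
  let ?Y = "filter (\<lambda>y. y \<in> Y) w" and ?X = "filter (\<lambda>x. x \<in> X) w"
  have "(w, ?Y @ ?X) \<in> swaps ^^ pair_count X Y w" using Cons by simp
  then have *: "(z # w, z # ?Y @ ?X) \<in> swaps ^^ pair_count X Y w" by (rule swaps_relpow_Cons)
  show ?case
  proof (cases "z \<in> X")
    case True
    then have "z \<notin> Y" using assms(1) by auto
    have "(z # w, ?Y @ z # ?X) \<in> swaps ^^ (pair_count X Y w + length ?Y)"
      unfolding relpow_add using * swaps_move[of z ?Y ?X] by blast
    then show ?thesis using True \<open>z \<notin> Y\<close> by (simp add: add.commute)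
  next
    case False
    then have "z \<in> Y" using Cons.prems by auto
    then show ?thesis using False * by simp
  qed
qed simp

text \<open>Every pair of an \<open>X\<close>-position and a \<open>Y\<close>-position is counted in
  exactly one of the two orders.\<close>

lemma pair_count_add:
  assumes "X \<inter> Y = {}"
  shows "pair_count X Y w + pair_count Y X w
    = length (filter (\<lambda>x. x \<in> X) w) * length (filter (\<lambda>y. y \<in> Y) w)"
  using assms by (induction w) auto

lemma pair_count_append:
  assumes "X \<inter> Y = {}" "set u \<subseteq> X" "set v \<subseteq> Y"
  shows "pair_count X Y (u @ v) = length u * length v"
proof -
  have "filter (\<lambda>y. y \<in> Y) u = []" using assms by (auto simp: filter_empty_conv)
  moreover have "filter (\<lambda>y. y \<in> Y) v = v" using assms by (auto simp: filter_id_conv)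
  moreover have "pair_count X Y v = 0" using assms(1,3) by (induction v) auto
  moreover have "length (filter (\<lambda>y. y \<in> Y) (u' @ v)) = length v" if "set u' \<subseteq> X" for u'
    using that assms(1) \<open>filter (\<lambda>y. y \<in> Y) v = v\<close> by (auto simp: filter_empty_conv)
  ultimately show ?thesis using assms(2) by (induction u) (auto split: if_splits)
qed

section \<open>Counting index pairs and detecting a reversal along a sequence\<close>

lemma card_less_pairs:
  fixes I :: "nat set"
  assumes "finite I"
  shows "2 * card {(i, j). i \<in> I \<and> j \<in> I \<and> i < j} + card I = card I * card I"
proof -
  let ?L = "{(i, j). i \<in> I \<and> j \<in> I \<and> i < j}"
  have fin: "finite ?L" by (rule finite_subset[of _ "I \<times> I"]) (use assms in auto)
  have "I \<times> I = (?L \<union> prod.swap ` ?L) \<union> (\<lambda>i. (i, i)) ` I"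
    by (auto simp: image_iff)
  then have "card (I \<times> I) = card ((?L \<union> prod.swap ` ?L) \<union> (\<lambda>i. (i, i)) ` I)"
    by (rule arg_cong)
  also have "\<dots> = card (?L \<union> prod.swap ` ?L) + card ((\<lambda>i. (i, i)) ` I)"
    using assms fin by (intro card_Un_disjoint) auto
  also have "card (?L \<union> prod.swap ` ?L) = card ?L + card (prod.swap ` ?L)"
    using fin by (intro card_Un_disjoint) auto
  also have "card (prod.swap ` ?L) = card ?L" by (intro card_image) auto
  also have "card ((\<lambda>i. (i, i)) ` I) = card I" by (intro card_image) (auto intro: inj_onI)
  finally show ?thesis by (simp add: card_cartesian_product)
qed

text \<open>A discrete intermediate value argument: the pair stays comparable, so without a direct
  reversal \<open>(x, y)\<close> would persist from time \<open>i\<close> to time \<open>j\<close>,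
  against asymmetry.\<close>

lemma flip_exists:
  fixes D :: "nat \<Rightarrow> ('c \<times> 'c) set"
  assumes "\<And>k. k \<le> n \<Longrightarrow> (x, y) \<in> D k \<or> (y, x) \<in> D k" "\<And>k. k \<le> n \<Longrightarrow> (x, y) \<in> D k \<Longrightarrow> (y, x) \<notin> D k"
    and "i \<le> j" "j \<le> n" "(x, y) \<in> D i" "(y, x) \<in> D j"
  shows "\<exists>k < n. (x, y) \<in> D k \<and> (y, x) \<in> D (Suc k)"
proof (rule ccontr)
  assume no: "\<not> ?thesis"
  have "j \<le> n \<longrightarrow> (x, y) \<in> D j"
    using \<open>i \<le> j\<close>
  proof (induction j rule: dec_induct)
    case (step k)
    then show ?case using no assms(1)[of "Suc k"] by auto
  qed (use assms in simp)
  then show False using assms by blast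
qed

section \<open>Distances in digraphs\<close>

lemma (in wf_digraph) awalk_imp_relpow: "awalk u p v \<Longrightarrow> (u, v) \<in> arcs_ends G ^^ length p"
proof (induction p arbitrary: u)
  case (Cons e p)
  then have "(u, head G e) \<in> arcs_ends G" "(head G e, v) \<in> arcs_ends G ^^ length p"
    by (auto simp: awalk_Cons_iff arcs_ends_conv)
  then show ?case by (simp add: relpow_Suc_I2 del: relpow.simps)
qed (simp add: awalk_Nil_iff)

lemma (in wf_digraph) relpow_imp_awalk:
  "(u, v) \<in> arcs_ends G ^^ n \<Longrightarrow> u \<in> verts G \<Longrightarrow> \<exists>p. awalk u p v \<and> length p = n"
proof (induction n arbitrary: u)
  case 0
  then show ?case by (auto simp: awalk_Nil_iff)
next
  case (Suc n)
  then obtain w where w: "(u, w) \<in> arcs_ends G" "(w, v) \<in> arcs_ends G ^^ n"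
    by (meson relpow_Suc_E2)
  then obtain e where e: "e \<in> arcs G" "tail G e = u" "head G e = w"
    by (auto simp: arcs_ends_conv)
  then obtain p where "awalk w p v" "length p = n" using Suc.IH[OF w(2)] by auto
  then have "awalk u (e # p) v" "length (e # p) = Suc n" using e by (auto simp: awalk_Cons_iff)
  then show ?case by blast
qed

lemma relpow_reflcl: "(u, v) \<in> (R \<union> Id) ^^ n \<Longrightarrow> \<exists>m \<le> n. (u, v) \<in> R ^^ m"
proof (induction n arbitrary: v)
  case (Suc n)
  then obtain w where w: "(u, w) \<in> (R \<union> Id) ^^ n" "(w, v) \<in> R \<union> Id" by auto
  then obtain m where m: "m \<le> n" "(u, w) \<in> R ^^ m" using Suc.IH by blast
  show ?case
  proof (cases "w = v")
    case True
    then show ?thesis using m le_Suc_eq by blast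
  next
    case False
    then have "(u, v) \<in> R ^^ Suc m" using w m by auto
    then show ?thesis using m by (meson Suc_le_mono)
  qed
qed auto

lemma (in wf_digraph) awalk_cost_unit: "awalk_cost (\<lambda>_. 1) p = real (length p)"
  unfolding awalk_cost_def by (induction p) simp_all

lemma (in wf_digraph) graph_distance_le:
  assumes "u \<in> verts G" "(u, v) \<in> (arcs_ends G \<union> Id) ^^ n"
  shows "graph_distance G u v \<le> ereal (real n)"
proof -
  obtain m where m: "m \<le> n" "(u, v) \<in> arcs_ends G ^^ m" using relpow_reflcl[OF assms(2)] by blast
  then obtain p where p: "awalk u p v" "length p = m" using relpow_imp_awalk[OF m(2) assms(1)] by blast
  have "graph_distance G u v \<le> awalk_cost (\<lambda>_. 1) p"
    unfolding graph_distance_def using p(1) by (rule min_cost_le_walk_cost)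
  also have "\<dots> \<le> ereal (real n)" using p m by (simp add: awalk_cost_unit)
  finally show ?thesis .
qed

lemma (in wf_digraph) graph_distance_ge:
  assumes "\<And>m. (u, v) \<in> arcs_ends G ^^ m \<Longrightarrow> n \<le> m"
  shows "ereal (real n) \<le> graph_distance G u v"
  unfolding graph_distance_def \<mu>_def
proof (rule INF_greatest)
  fix p assume "p \<in> {p. awalk u p v}"
  then have "n \<le> length p" using assms awalk_imp_relpow by blast
  then show "ereal (real n) \<le> ereal (awalk_cost (\<lambda>_. 1) p)" by (simp add: awalk_cost_unit)
qed

section \<open>Search trees of complete bipartite graphs as vertex orderings\<close>

locale bipartition =
  fixes A B :: "'a set"
  assumes disjoint: "A \<inter> B = {}"
begin

text \<open>Encodes connectivity: a set of vertices of the complete bipartite graph induces a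
  connected graph iff it is mixed or a singleton.\<close>

definition mixed :: "'a set \<Rightarrow> bool" where
  "mixed W \<longleftrightarrow> W \<inter> A \<noteq> {} \<and> W \<inter> B \<noteq> {}"

lemma mixed_mono: "mixed W \<Longrightarrow> W \<subseteq> W' \<Longrightarrow> mixed W'"
  by (auto simp: mixed_def)

text \<open>Every search tree is \<open>tree_of xs\<close> for some ordering \<open>xs\<close> of the vertices; the orderings of a tree
  differ only in the order of its leaves. The value at \<open>[]\<close> is junk.\<close>

primrec tree_of :: "'a list \<Rightarrow> 'a rtree" where
  "tree_of [] = undefined"
| "tree_of (x # xs) = Node x (if mixed (set xs) then {|tree_of xs|}
     else (\<lambda>v. Node v {||}) |`| fset_of_list xs)"

text \<open>The vertex set of the subtree rooted at \<open>x\<close> when \<open>W\<close> is what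
  follows \<open>x\<close> in the ordering: all that remains while this is mixed; otherwise
  \<open>x\<close> is a leaf.\<close>

definition tube :: "'a \<Rightarrow> 'a set \<Rightarrow> 'a set" where
  "tube x W = (if mixed (insert x W) then insert x W else {x})"

primrec tubes_of :: "'a list \<Rightarrow> 'a set set" where
  "tubes_of [] = {}"
| "tubes_of (x # xs) = insert (tube x (set xs)) (tubes_of xs)"

text \<open>Pairs of an ancestor and a proper descendant in \<open>tree_of xs\<close>, provided \<open>xs\<close> meets both parts.\<close>

primrec ancestry :: "'a list \<Rightarrow> ('a \<times> 'a) set" where
  "ancestry [] = {}"
| "ancestry (x # xs) = (if mixed (insert x (set xs)) then {x} \<times> set xs else {}) \<union> ancestry xs"

lemma not_mixed_empty: "\<not> mixed {}"
  by (simp add: mixed_def)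

lemma vertices_tree_of: "xs \<noteq> [] \<Longrightarrow> vertices (tree_of xs) = set xs"
proof (induction xs)
  case (Cons x xs)
  then show ?case
    by (cases "xs = []") (auto simp: fset_of_list.rep_eq not_mixed_empty split: if_splits)
qed simp

lemma tubes_Node: "tubes (Node r ts) = insert (vertices (Node r ts)) (\<Union>t \<in> fset ts. tubes t)"
  by (auto simp: tubes_def image_UN)

lemma tubes_leaf: "tubes (Node v {||}) = {{v}}"
  by (simp add: tubes_Node)

lemma tubes_of_not_mixed: "\<not> mixed (set xs) \<Longrightarrow> tubes_of xs = (\<lambda>v. {v}) ` set xs"
proof (induction xs)
  case (Cons x xs)
  then have "\<not> mixed (set xs)" using mixed_mono[of "set xs" "set (x # xs)"] by auto
  with Cons show ?case by (simp add: tube_def)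
qed simp

text \<open>Mixedness excludes longer lists inside one part, where \<open>tree_of\<close> is a star
  whose root tube is the whole set, but \<open>tubes_of\<close> yields singletons only.\<close>

lemma tubes_tree_of: "mixed (set xs) \<Longrightarrow> tubes (tree_of xs) = tubes_of xs"
proof (induction xs)
  case (Cons x xs)
  have "tubes (tree_of (x # xs)) = insert (set (x # xs)) (if mixed (set xs) then tubes (tree_of xs)
    else (\<lambda>v. {v}) ` set xs)"
    using vertices_tree_of[of "x # xs"]
    by (auto simp: tubes_Node fset_of_list.rep_eq tubes_leaf)
  then show ?case using Cons tubes_of_not_mixed[of xs] by (simp add: tube_def)
qed (simp add: not_mixed_empty)

text \<open>A suffix inside one part ends up among the leaves, which form an unordered set. This
  makes reordering one part free in the upper bound.\<close>

lemma tree_of_append_cong: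
  assumes "mixed (set (us @ vs))" "set vs = set vs'" "\<not> mixed (set vs)"
  shows "tree_of (us @ vs) = tree_of (us @ vs')"
  using assms
proof (induction us)
  case (Cons u us)
  show ?case
  proof (cases "mixed (set (us @ vs))")
    case True
    then show ?thesis using Cons by (simp add: Un_commute)
  next
    case False
    moreover have "fset_of_list (us @ vs) = fset_of_list (us @ vs')"
      using Cons.prems(2) by (simp add: fset_of_list.rep_eq fset_inject[symmetric])
    ultimately show ?thesis using Cons.prems by simp
  qed
qed simp

section \<open>Ancestry read off from the tubes\<close>

lemma in_tube: "x \<in> tube x W" and tube_subset: "tube x W \<subseteq> insert x W"
  by (auto simp: tube_def)

lemma tubes_of_subset: "t \<in> tubes_of xs \<Longrightarrow> t \<subseteq> set xs"
proof (induction xs)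
  case (Cons x xs)
  then show ?case using tube_subset[of x "set xs"] by auto
qed simp

lemma ancestry_subset: "ancestry xs \<subseteq> set xs \<times> set xs"
  by (induction xs) auto

text \<open>The witness is the tube rooted at \<open>x\<close>. A tube of an earlier vertex that
  contains \<open>x\<close> is not a singleton, hence contains all later vertices.\<close>

lemma least_tube:
  assumes "distinct xs" "x \<in> set xs"
  shows "\<exists>t \<in> tubes_of xs. x \<in> t \<and> (\<forall>s \<in> tubes_of xs. x \<in> s \<longrightarrow> t \<subseteq> s)"
  using assms
proof (induction xs)
  case (Cons z xs)
  show ?case
  proof (cases "x = z")
    case True
    then have "\<forall>s \<in> tubes_of xs. x \<notin> s" using Cons.prems tubes_of_subset by fastforce
    with True show ?thesis by (auto simp: in_tube)
  next
    case False
    then obtain t where t: "t \<in> tubes_of xs" "x \<in> t" "\<forall>s \<in> tubes_of xs. x \<in> s \<longrightarrow> t \<subseteq> s"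
      using Cons by auto
    have "x \<in> tube z (set xs) \<Longrightarrow> t \<subseteq> tube z (set xs)"
      using False tubes_of_subset[OF t(1)] by (auto simp: tube_def split: if_splits)
    with t show ?thesis by auto
  qed
qed simp

text \<open>The tubes containing \<open>x\<close> are those rooted at \<open>x\<close> or at its
  ancestors. Expressed through tubes, ancestry becomes an invariant of the tree instead of the
  ordering, and comparable with rotations.\<close>

lemma ancestry_iff:
  assumes "distinct xs" "x \<in> set xs" "y \<in> set xs" "x \<noteq> y"
  shows "(x, y) \<in> ancestry xs \<longleftrightarrow> (\<forall>t \<in> tubes_of xs. x \<in> t \<longrightarrow> y \<in> t)"
  using assms
proof (induction xs)
  case (Cons z xs)
  consider "x = z" | "y = z" "x \<in> set xs" | "x \<in> set xs" "y \<in> set xs" "x \<noteq> z" "y \<noteq> z"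
    using Cons.prems by auto
  then show ?case
  proof cases
    case 1
    then have "\<forall>s \<in> tubes_of xs. x \<notin> s" using Cons.prems tubes_of_subset by fastforce
    moreover have "(x, y) \<notin> ancestry xs" using 1 Cons.prems ancestry_subset[of xs] by auto
    ultimately show ?thesis using 1 Cons.prems by (auto simp: tube_def split: if_splits)
  next
    case 2
    then have "(x, y) \<notin> ancestry (z # xs)" using Cons.prems ancestry_subset[of xs] by auto
    moreover obtain t where "t \<in> tubes_of xs" "x \<in> t" using least_tube[of xs x] 2 Cons.prems by auto
    moreover have "y \<notin> t" using tubes_of_subset[OF \<open>t \<in> tubes_of xs\<close>] 2 Cons.prems by auto
    ultimately show ?thesis by auto
  next
    case 3
    then show ?thesis using Cons by (auto simp: tube_def split: if_splits)
  qed
qed simp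

lemma ancestry_asym: "distinct xs \<Longrightarrow> (x, y) \<in> ancestry xs \<Longrightarrow> (y, x) \<notin> ancestry xs"
proof (induction xs)
  case (Cons z xs)
  then show ?case using ancestry_subset[of xs] by (auto split: if_splits)
qed simp

lemma ancestry_irrefl: "distinct xs \<Longrightarrow> (x, y) \<in> ancestry xs \<Longrightarrow> x \<noteq> y"
  using ancestry_asym by blast

lemma ancestry_cong:
  assumes "distinct u" "distinct v" "set u = set v" "tubes_of u = tubes_of v"
  shows "ancestry u = ancestry v"
proof -
  have "ancestry u \<subseteq> ancestry v" if "distinct u" "distinct v" "set u = set v" "tubes_of u = tubes_of v" for u v
  proof (rule subrelI)
    fix x y assume xy: "(x, y) \<in> ancestry u"
    then have *: "x \<in> set u" "y \<in> set u" "x \<noteq> y"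
      using ancestry_subset[of u] ancestry_irrefl[OF that(1)] by auto
    then have "\<forall>t \<in> tubes_of u. x \<in> t \<longrightarrow> y \<in> t" using xy ancestry_iff[OF that(1)] by simp
    then show "(x, y) \<in> ancestry v" using ancestry_iff[OF that(2), of x y] * that(3,4) by simp
  qed
  with assms show ?thesis by (intro equalityI) auto
qed

text \<open>The suffix starting with the earlier of the two meets both parts.\<close>

lemma ancestry_comparable:
  assumes "a \<in> A" "b \<in> B" "a \<in> set xs" "b \<in> set xs"
  shows "(a, b) \<in> ancestry xs \<or> (b, a) \<in> ancestry xs"
  using assms(3,4)
proof (induction xs)
  case (Cons x xs)
  have "a \<noteq> b" using assms disjoint by auto
  then show ?case using Cons assms(1,2) by (auto simp: mixed_def)
qed simp

text \<open>Incomparability means that the suffix from the earlier of \<open>b\<close> and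
  \<open>b'\<close> on is not mixed, so it contains no element of \<open>A\<close>. Thus
  \<open>a\<close> comes before both, and the suffix from \<open>a\<close> on is mixed.\<close>

lemma ancestry_incomparable:
  assumes "b \<in> B" "b' \<in> B" "b \<noteq> b'" "a \<in> A" "a \<in> set xs" "b \<in> set xs" "b' \<in> set xs"
    "(b, b') \<notin> ancestry xs" "(b', b) \<notin> ancestry xs"
  shows "(a, b) \<in> ancestry xs"
  using assms(5-)
proof (induction xs)
  case (Cons x xs)
  have "a \<noteq> b" "a \<noteq> b'" using assms disjoint by auto
  then show ?case using Cons assms(1-4) by (auto simp: mixed_def split: if_splits)
qed simp

text \<open>The nonempty final block in \<open>A\<close> makes every suffix that starts inside
  \<open>us\<close> mixed.\<close>

lemma ancestry_append:
  assumes "distinct (us @ vs)" "set vs \<subseteq> A" "vs \<noteq> []" "set us \<subseteq> B"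
  shows "u \<in> set us \<Longrightarrow> v \<in> set vs \<Longrightarrow> (u, v) \<in> ancestry (us @ vs)"
    and "i < j \<Longrightarrow> j < length us \<Longrightarrow> (us ! i, us ! j) \<in> ancestry (us @ vs)"
proof -
  show "u \<in> set us \<Longrightarrow> v \<in> set vs \<Longrightarrow> (u, v) \<in> ancestry (us @ vs)"
    using assms by (induction us) (auto simp: mixed_def)
  show "i < j \<Longrightarrow> j < length us \<Longrightarrow> (us ! i, us ! j) \<in> ancestry (us @ vs)"
    using assms
  proof (induction us arbitrary: i j)
    case (Cons u us)
    have m: "mixed (insert u (set (us @ vs)))" using Cons.prems by (cases vs) (auto simp: mixed_def)
    show ?case
    proof (cases i)
      case 0
      then show ?thesis using m Cons.prems by (cases j) auto
    next
      case (Suc k)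
      then show ?thesis using Cons.IH[of k "j - 1"] Cons.prems by (cases j) auto
    qed
  qed simp
qed

section \<open>The effect of one rotation on ancestry\<close>

text \<open>
  If the rotation replaces the tube \<open>t\<close> by \<open>t'\<close> and \<open>x\<close> passes from above \<open>y\<close> to below \<open>y\<close>, then
  \<open>y\<close> is the root of \<open>t\<close> in the old tree and \<open>x\<close> the root of \<open>t'\<close> in the new one.
\<close>

lemma flip_root:
  assumes "distinct xs" "distinct ys" "set xs = set ys"
    and "tubes_of xs - tubes_of ys = {t}"
    and "(x, y) \<in> ancestry xs" "(y, x) \<in> ancestry ys"
  shows "y \<in> t \<and> (\<forall>s \<in> tubes_of xs. y \<in> s \<longrightarrow> t \<subseteq> s)"
proof -
  have xy: "x \<in> set xs" "y \<in> set xs" "x \<noteq> y"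
    using assms ancestry_subset[of xs] ancestry_irrefl by blast+
  have "(y, x) \<notin> ancestry xs" using assms ancestry_asym by blast
  then obtain s where s: "s \<in> tubes_of xs" "y \<in> s" "x \<notin> s" using ancestry_iff assms(1) xy by blast
  obtain m where m: "m \<in> tubes_of xs" "y \<in> m" "\<forall>s \<in> tubes_of xs. y \<in> s \<longrightarrow> m \<subseteq> s"
    using least_tube[OF assms(1) xy(2)] by blast
  have "x \<notin> m" using m s by blast
  then have "m \<notin> tubes_of ys" using assms xy m(2) ancestry_iff[of ys y x] by auto
  with m assms(4) show ?thesis by blast
qed

text \<open>While \<open>x\<close> is above \<open>y\<close>, some tube contains \<open>y\<close>
  but not \<open>x\<close>; it cannot survive once \<open>y\<close> is above
  \<open>x\<close>.\<close>

lemma flip_separates: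
  assumes "distinct xs" "distinct ys" "set xs = set ys"
    and "(x, y) \<in> ancestry xs" "(y, x) \<in> ancestry ys"
  obtains t where "t \<in> tubes_of xs - tubes_of ys"
proof -
  have xy: "x \<in> set xs" "y \<in> set xs" "x \<noteq> y"
    using assms ancestry_subset[of xs] ancestry_irrefl by blast+
  have "(y, x) \<notin> ancestry xs" using assms ancestry_asym by blast
  then obtain s where s: "s \<in> tubes_of xs" "y \<in> s" "x \<notin> s" using ancestry_iff assms(1) xy by blast
  then have "s \<notin> tubes_of ys" using assms xy ancestry_iff[of ys y x] by auto
  with s that show thesis by blast
qed

text \<open>By \<open>flip_separates\<close> in both directions, a symmetric difference of size two
  consists of one lost and one gained tube. By \<open>flip_root\<close>, \<open>y\<close> is the
  root of the lost tube and \<open>x\<close> that of the gained one, and a tube has only one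
  root.\<close>

lemma flip_unique:
  assumes "distinct xs" "distinct ys" "set xs = set ys"
    and "card ((tubes_of xs - tubes_of ys) \<union> (tubes_of ys - tubes_of xs)) = 2"
    and "(x, y) \<in> ancestry xs" "(y, x) \<in> ancestry ys" "(x', y') \<in> ancestry xs" "(y', x') \<in> ancestry ys"
  shows "x = x' \<and> y = y'"
proof -
  obtain t where t: "t \<in> tubes_of xs - tubes_of ys" using flip_separates[of xs ys x y] assms by metis
  obtain t' where t': "t' \<in> tubes_of ys - tubes_of xs" using flip_separates[of ys xs y x] assms by metis
  have "finite ((tubes_of xs - tubes_of ys) \<union> (tubes_of ys - tubes_of xs))"
    using assms(4) by (intro card_ge_0_finite) simp
  moreover have "card {t, t'} = 2" using t t' by (auto simp: card_2_iff)
  ultimately have tt': "{t, t'} = (tubes_of xs - tubes_of ys) \<union> (tubes_of ys - tubes_of xs)"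
    using t t' assms(4) by (intro card_seteq) auto
  have "tubes_of xs - tubes_of ys = {t, t'} \<inter> tubes_of xs" "tubes_of ys - tubes_of xs = {t, t'} \<inter> tubes_of ys"
    unfolding tt' by auto
  then have d: "tubes_of xs - tubes_of ys = {t}" "tubes_of ys - tubes_of xs = {t'}" using t t' by auto
  have in_set: "x \<in> set xs" "y \<in> set xs" "x' \<in> set xs" "y' \<in> set xs"
    using assms ancestry_subset[of xs] by blast+
  have same_root: "u = v" if "distinct zs" "u \<in> set zs" "v \<in> set zs"
    "u \<in> s \<and> (\<forall>r \<in> tubes_of zs. u \<in> r \<longrightarrow> s \<subseteq> r)" "v \<in> s \<and> (\<forall>r \<in> tubes_of zs. v \<in> r \<longrightarrow> s \<subseteq> r)" for zs u v s
    using that ancestry_iff[of zs u v] ancestry_iff[of zs v u] ancestry_asym[of zs u v] by blast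
  have "y = y'"
    using same_root[of xs y y' t] flip_root[of xs ys t] d assms in_set by metis
  moreover have "x = x'"
    using same_root[of ys x x' t'] flip_root[of ys xs t'] d assms in_set by metis
  ultimately show ?thesis by simp
qed

text \<open>A swap among the leaves does not change the tree. Any other swap changes only the tube
  rooted at the lower of the two vertices.\<close>

lemma swap_rotation:
  assumes "distinct (us @ x # y # vs)" "mixed (set (us @ x # y # vs))"
  shows "tree_of (us @ x # y # vs) = tree_of (us @ y # x # vs)
    \<or> rotation (tree_of (us @ x # y # vs)) (tree_of (us @ y # x # vs))"
proof (cases "mixed (insert x (insert y (set vs)))")
  case False
  then show ?thesis using tree_of_append_cong[of us "x # y # vs" "y # x # vs"] assms
    by (simp add: insert_commute)
next
  case True
  define t where "t = tube y (set vs)"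
  define t' where "t' = tube x (set vs)"
  define s where "s = insert x (insert y (set vs))"
  \<comment> \<open>\<open>P\<close> collects the tubes rooted in \<open>us\<close>. They depend
    only on the set of vertices that follow, so both orderings share them; each contains its root,
    which tells it apart from \<open>t\<close> and \<open>t'\<close>.\<close>
  obtain P where P: "tubes_of (us @ x # y # vs) = P \<union> tubes_of (x # y # vs)"
    "tubes_of (us @ y # x # vs) = P \<union> tubes_of (y # x # vs)" "\<forall>p \<in> P. p \<inter> set us \<noteq> {}"
  proof -
    have "\<exists>P. (\<forall>p \<in> P. p \<inter> set us \<noteq> {}) \<and> tubes_of (us @ x # y # vs) = P \<union> tubes_of (x # y # vs)
      \<and> tubes_of (us @ y # x # vs) = P \<union> tubes_of (y # x # vs)"
    proof (induction us)
      case (Cons u us)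
      then obtain P where P: "\<forall>p \<in> P. p \<inter> set us \<noteq> {}"
        "tubes_of (us @ x # y # vs) = P \<union> tubes_of (x # y # vs)"
        "tubes_of (us @ y # x # vs) = P \<union> tubes_of (y # x # vs)" by blast
      let ?t = "tube u (set (us @ x # y # vs))"
      have "set (us @ y # x # vs) = set (us @ x # y # vs)" by auto
      then have "tubes_of ((u # us) @ x # y # vs) = insert ?t P \<union> tubes_of (x # y # vs)"
        "tubes_of ((u # us) @ y # x # vs) = insert ?t P \<union> tubes_of (y # x # vs)"
        using P by (simp_all only: append_Cons tubes_of.simps) auto
      moreover have "\<forall>p \<in> insert ?t P. p \<inter> set (u # us) \<noteq> {}" using P in_tube by fastforce
      ultimately show ?case by blast
    qed simp
    with that show thesis by blast
  qed
  have e: "tubes_of (x # y # vs) = {s, t} \<union> tubes_of vs" "tubes_of (y # x # vs) = {s, t'} \<union> tubes_of vs"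
    using True by (auto simp: s_def t_def t'_def tube_def insert_commute)
  have tt: "y \<in> t" "x \<notin> t" "x \<in> t'" "y \<notin> t'" "t \<inter> set us = {}" "t' \<inter> set us = {}"
    using assms in_tube[of y "set vs"] in_tube[of x "set vs"]
      tube_subset[of y "set vs"] tube_subset[of x "set vs"] by (auto simp: t_def t'_def)
  have "t \<notin> tubes_of vs" "t' \<notin> tubes_of vs" using tubes_of_subset[of _ vs] tt assms(1) by auto
  moreover have "t \<notin> P" "t' \<notin> P" using P(3) tt by auto
  moreover have "t \<noteq> s" "t' \<noteq> s" "t \<noteq> t'" using tt by (auto simp: s_def)
  ultimately have "(tubes_of (us @ x # y # vs) - tubes_of (us @ y # x # vs))
    \<union> (tubes_of (us @ y # x # vs) - tubes_of (us @ x # y # vs)) = {t, t'}"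
    unfolding P(1,2) e by blast
  moreover have "mixed (set (us @ y # x # vs))" using assms(2) by (auto simp: insert_commute)
  ultimately have "rotation (tree_of (us @ x # y # vs)) (tree_of (us @ y # x # vs))"
    using assms(2) \<open>t \<noteq> t'\<close> by (simp add: rotation_def tubes_tree_of del: set_append)
  then show ?thesis ..
qed

end


section \<open>Components and search trees of the complete bipartite graph\<close>

locale complete_bipartite = graph G + bipartition A B
  for G :: "('a, 'b) pre_digraph" (structure) and A B :: "'a set" +
  assumes verts_eq: "verts G = A \<union> B"
    and ends_eq: "arcs_ends G = A \<times> B \<union> B \<times> A"
    and nonempty: "A \<noteq> {}" "B \<noteq> {}"
begin

lemma mixed_verts: "mixed (verts G)"
  using nonempty by (auto simp: mixed_def verts_eq)

lemma ends_induce: "arcs_ends (G \<restriction> S) = (A \<times> B \<union> B \<times> A) \<inter> S \<times> S"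
  unfolding ends_eq[symmetric] by (auto simp: arcs_ends_conv)

lemma induce_verts: "G \<restriction> verts G = G"
  by (rule pre_digraph.equality) (auto simp: induce_subgraph_def)

text \<open>In a mixed set, two vertices of the same part are joined through one of the other part.
  A set inside one part spans no arcs, so being connected leaves it a single vertex.\<close>

lemma strongly_connected_induce:
  assumes "S \<subseteq> verts G"
  shows "strongly_connected (G \<restriction> S) \<longleftrightarrow> mixed S \<or> (\<exists>v. S = {v})"
proof
  interpret S: wf_digraph "G \<restriction> S" by (rule wellformed_induce_subgraph)
  assume sc: "strongly_connected (G \<restriction> S)"
  show "mixed S \<or> (\<exists>v. S = {v})"
  proof (cases "mixed S")
    case False
    then have "arcs_ends (G \<restriction> S) = {}" by (auto simp: ends_induce mixed_def)
    moreover obtain u where "u \<in> S" using sc by (auto simp: strongly_connected_def)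
    ultimately have "v = u" if "v \<in> S" for v
    proof -
      have "u \<rightarrow>\<^sup>*\<^bsub>G \<restriction> S\<^esub> v" using sc that \<open>u \<in> S\<close> by (simp add: strongly_connected_def)
      then show ?thesis
        using \<open>arcs_ends (G \<restriction> S) = {}\<close> by (cases rule: S.converse_reachable_cases) auto
    qed
    then show ?thesis using \<open>u \<in> S\<close> by blast
  qed simp
next
  interpret S: wf_digraph "G \<restriction> S" by (rule wellformed_induce_subgraph)
  assume "mixed S \<or> (\<exists>v. S = {v})"
  then show "strongly_connected (G \<restriction> S)"
  proof
    assume "mixed S"
    then obtain a b where ab: "a \<in> A" "a \<in> S" "b \<in> B" "b \<in> S" by (auto simp: mixed_def)
    show ?thesis
    proof
      fix u v assume "u \<in> verts (G \<restriction> S)" "v \<in> verts (G \<restriction> S)"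
      then have uv: "u \<in> S" "v \<in> S" by auto
      have *: "x \<in> S \<Longrightarrow> y \<in> S \<Longrightarrow> x \<in> A \<and> y \<in> B \<or> x \<in> B \<and> y \<in> A \<Longrightarrow> x \<rightarrow>\<^bsub>G \<restriction> S\<^esub> y" for x y
        by (auto simp: ends_induce)
      consider "u \<in> A \<and> v \<in> B \<or> u \<in> B \<and> v \<in> A" | "u \<in> A" "v \<in> A" | "u \<in> B" "v \<in> B"
        using assms uv by (auto simp: verts_eq)
      then show "u \<rightarrow>\<^sup>*\<^bsub>G \<restriction> S\<^esub> v"
      proof cases
        case 1
        then show ?thesis using *[OF uv] by blast
      next
        case 2
        then show ?thesis using *[of u b] *[of b v] ab uv by (blast intro: S.adj_reachable_trans)
      next
        case 3
        then show ?thesis using *[of u a] *[of a v] ab uv by (blast intro: S.adj_reachable_trans)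
      qed
    qed (use ab in auto)
  next
    assume "\<exists>v. S = {v}"
    then obtain v where v: "S = {v}" by blast
    then have "v \<rightarrow>\<^sup>*\<^bsub>G \<restriction> S\<^esub> v" by (intro S.reachable_refl) simp
    with v show ?thesis by (simp add: strongly_connected_def)
  qed
qed

lemma induced_subgraph_iff:
  assumes "W \<subseteq> verts G"
  shows "induced_subgraph H (G \<restriction> W) \<longleftrightarrow> (\<exists>S \<subseteq> W. H = G \<restriction> S)"
proof
  assume H: "induced_subgraph H (G \<restriction> W)"
  then have *: "verts H \<subseteq> W" "compatible (G \<restriction> W) H"
    "arcs H = {e \<in> arcs (G \<restriction> W). tail G e \<in> verts H \<and> head G e \<in> verts H}"
    by (auto simp: induced_subgraph_def subgraph_def)
  have "H = G \<restriction> verts H"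
  proof (rule pre_digraph.equality)
    show "arcs H = arcs (G \<restriction> verts H)" using * by auto
  qed (use *(2) in \<open>auto simp: compatible_def\<close>)
  with * show "\<exists>S \<subseteq> W. H = G \<restriction> S" by blast
next
  assume "\<exists>S \<subseteq> W. H = G \<restriction> S"
  then obtain S where "S \<subseteq> W" "H = G \<restriction> S" by blast
  then show "induced_subgraph H (G \<restriction> W)"
    by (auto simp: induced_subgraph_def subgraph_def compatible_def wellformed_induce_subgraph)
qed

text \<open>The dichotomy behind \<open>tree_of\<close>: what remains is either connected or
  edgeless. Maximality among connected induced subgraphs is translated into maximality among subsets
  of \<open>W\<close>.\<close>

lemma sccs_induce:
  assumes "W \<subseteq> verts G"
  shows "pre_digraph.sccs (G \<restriction> W) = (if mixed W then {G \<restriction> W} else (\<lambda>v. G \<restriction> {v}) ` W)"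
proof -
  define P where "P S \<longleftrightarrow> mixed S \<or> (\<exists>v. S = {v})" for S
  have conn: "strongly_connected (G \<restriction> S) \<longleftrightarrow> P S" if "S \<subseteq> W" for S
    using strongly_connected_induce that assms unfolding P_def by blast
  have max: "(\<exists>H'. (\<exists>S \<subseteq> W. H' = G \<restriction> S) \<and> strongly_connected H' \<and> T \<subset> verts H')
      \<longleftrightarrow> (\<exists>S \<subseteq> W. P S \<and> T \<subset> S)" for T
    using conn by (metis induce_subgraph_verts)
  have "pre_digraph.sccs (G \<restriction> W)
      = (\<lambda>S. G \<restriction> S) ` {S. S \<subseteq> W \<and> P S \<and> \<not> (\<exists>S' \<subseteq> W. P S' \<and> S \<subset> S')}"
    unfolding pre_digraph.sccs_def induced_subgraph_iff[OF assms] max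
    by (rule set_eqI, simp add: image_iff) (metis conn induce_subgraph_verts)
  also have "\<dots> = (if mixed W then {G \<restriction> W} else (\<lambda>v. G \<restriction> {v}) ` W)"
  proof (cases "mixed W")
    case True
    then have "P W" by (simp add: P_def)
    then have "{S. S \<subseteq> W \<and> P S \<and> \<not> (\<exists>S' \<subseteq> W. P S' \<and> S \<subset> S')} = {W}" by blast
    then show ?thesis using True by simp
  next
    case False
    then have single: "P S \<longleftrightarrow> (\<exists>v. S = {v})" if "S \<subseteq> W" for S
      using that mixed_mono[of S W] by (auto simp: P_def)
    have "{S. S \<subseteq> W \<and> P S \<and> \<not> (\<exists>S' \<subseteq> W. P S' \<and> S \<subset> S')} = (\<lambda>v. {v}) ` W"
    proof (intro equalityI subsetI)
      fix S assume "S \<in> (\<lambda>v. {v}) ` W"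
      then obtain v where v: "S = {v}" "v \<in> W" by blast
      have "\<not> S \<subset> S'" if "S' \<subseteq> W" "P S'" for S' using single[OF that(1)] that(2) v by auto
      then show "S \<in> {S. S \<subseteq> W \<and> P S \<and> \<not> (\<exists>S' \<subseteq> W. P S' \<and> S \<subset> S')}"
        using v single[of S] by simp
    next
      fix S assume "S \<in> {S. S \<subseteq> W \<and> P S \<and> \<not> (\<exists>S' \<subseteq> W. P S' \<and> S \<subset> S')}"
      then show "S \<in> (\<lambda>v. {v}) ` W" using single[of S] by auto
    qed
    then show ?thesis using False by (simp add: image_image)
  qed
  finally show ?thesis .
qed

lemma del_vert_induce: "pre_digraph.del_vert (G \<restriction> W) r = G \<restriction> (W - {r})"
  by (auto simp: pre_digraph.del_vert_def induce_subgraph_def)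

lemma search_tree_leaf: "v \<in> verts G \<Longrightarrow> search_tree (G \<restriction> {v}) (Node v {||})"
  by (rule search_tree.Node) (auto simp: del_vert_induce sccs_induce not_mixed_empty)

lemma search_tree_tree_of:
  "xs \<noteq> [] \<Longrightarrow> distinct xs \<Longrightarrow> set xs \<subseteq> verts G \<Longrightarrow> search_tree (G \<restriction> set xs) (tree_of xs)"
proof (induction xs)
  case (Cons x xs)
  \<comment> \<open>In the mixed case the rest is the only component. Otherwise each component is a
    single vertex, recovered by \<open>the_elem\<close>.\<close>
  define f where "f H = (if mixed (set xs) then tree_of xs else Node (the_elem (verts H)) {||})"
    for H :: "('a, 'b) pre_digraph"
  have del: "pre_digraph.del_vert (G \<restriction> set (x # xs)) x = G \<restriction> set xs"
    using Cons.prems by (simp add: del_vert_induce)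
  have sccs: "pre_digraph.sccs (G \<restriction> set xs)
      = (if mixed (set xs) then {G \<restriction> set xs} else (\<lambda>v. G \<restriction> {v}) ` set xs)"
    using Cons.prems by (intro sccs_induce) simp
  show ?case
    unfolding tree_of.simps
  proof (rule search_tree.Node[where f = f])
    show "search_tree H (f H)"
      if "H \<in> pre_digraph.sccs (pre_digraph.del_vert (G \<restriction> set (x # xs)) x)" for H
      using that Cons search_tree_leaf not_mixed_empty
      unfolding del sccs by (cases "xs = []") (auto simp: f_def split: if_splits)
  qed (unfold del sccs, auto simp: f_def fset_of_list.rep_eq image_image)
qed simp

text \<open>Stated for induced subgraphs so that the induction reaches the components. A connected
  rest brings its own ordering; isolated vertices may be enumerated arbitrarily.\<close>

lemma search_tree_imp_tree_of:
  assumes "search_tree H T" "H = G \<restriction> W" "W \<subseteq> verts G"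
  shows "\<exists>xs. xs \<noteq> [] \<and> distinct xs \<and> set xs = W \<and> T = tree_of xs"
  using assms
proof (induction arbitrary: W)
  case (Node r H f ts)
  have r: "r \<in> W" using Node by simp
  have sub: "W - {r} \<subseteq> verts G" using Node.prems by auto
  have sccs: "pre_digraph.sccs (pre_digraph.del_vert H r)
      = (if mixed (W - {r}) then {G \<restriction> (W - {r})} else (\<lambda>v. G \<restriction> {v}) ` (W - {r}))"
    using sccs_induce[OF sub] Node.prems by (simp add: del_vert_induce)
  show ?case
  proof (cases "mixed (W - {r})")
    case True
    then obtain xs where xs: "distinct xs" "set xs = W - {r}" "f (G \<restriction> (W - {r})) = tree_of xs"
      using Node.IH[of "G \<restriction> (W - {r})" "W - {r}"] sub sccs by auto
    have "fset ts = fset {|tree_of xs|}" using Node.hyps(3) True xs(3) unfolding sccs by simp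
    then have "ts = {|tree_of xs|}" by (simp only: fset_inject)
    then have "Node r ts = tree_of (r # xs)" using xs True by simp
    moreover have "distinct (r # xs)" "set (r # xs) = W" using xs r by auto
    ultimately show ?thesis by blast
  next
    case False
    have leaf: "f (G \<restriction> {v}) = Node v {||}" if v: "v \<in> W - {r}" for v
    proof -
      obtain xs where xs: "xs \<noteq> []" "distinct xs" "set xs = {v}" "f (G \<restriction> {v}) = tree_of xs"
        using Node.IH[of "G \<restriction> {v}" "{v}"] v sub False sccs by auto
      then have "xs = [v]" by (cases xs; cases "tl xs") auto
      then show ?thesis using xs(4) by (simp add: not_mixed_empty)
    qed
    have "finite (W - {r})" using sub finite_verts finite_subset by blast
    then obtain xs where xs: "set xs = W - {r}" "distinct xs" using finite_distinct_list by blast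
    have "fset ts = fset ((\<lambda>v. Node v {||}) |`| fset_of_list xs)"
      using Node.hyps(3) False xs(1) leaf unfolding sccs
      by (simp add: fset_of_list.rep_eq image_image)
    then have "ts = (\<lambda>v. Node v {||}) |`| fset_of_list xs" by (simp only: fset_inject)
    then have "Node r ts = tree_of (r # xs)" using xs False by simp
    moreover have "distinct (r # xs)" "set (r # xs) = W" using xs r by auto
    ultimately show ?thesis by blast
  qed
qed

lemma search_tree_iff: "search_tree G T \<longleftrightarrow> (\<exists>xs. distinct xs \<and> set xs = verts G \<and> T = tree_of xs)"
proof
  assume "search_tree G T"
  then show "\<exists>xs. distinct xs \<and> set xs = verts G \<and> T = tree_of xs"
    using search_tree_imp_tree_of[of G T "verts G"] induce_verts by auto
next
  assume "\<exists>xs. distinct xs \<and> set xs = verts G \<and> T = tree_of xs"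
  then obtain xs where xs: "distinct xs" "set xs = verts G" "T = tree_of xs" by blast
  then have "xs \<noteq> []" using mixed_verts not_mixed_empty by auto
  then show "search_tree G T" using search_tree_tree_of[of xs] xs induce_verts by simp
qed


section \<open>The rotation graph and the upper bound\<close>

abbreviation rotation_graph :: "('a rtree, 'a rtree \<times> 'a rtree) pre_digraph" where
  "rotation_graph \<equiv> with_proj (associahedron_graph G)"

lemma wf_rotation_graph: "wf_digraph rotation_graph"
  by (simp add: wf_digraph_wp_iff pair_wf_digraph_associahedron_graph)

lemma verts_rotation_graph: "verts rotation_graph = {T. search_tree G T}"
  by (simp add: associahedron_graph_def)

lemma ends_rotation_graph:
  "arcs_ends rotation_graph = {(S, T). search_tree G S \<and> search_tree G T \<and> rotation S T}"
  by (simp add: associahedron_graph_def)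

text \<open>Each swap is a rotation or, among leaves, an idle step absorbed by
  \<open>Id\<close>.\<close>

lemma swaps_rotations:
  assumes "(u, v) \<in> swaps ^^ n" "distinct u" "set u = verts G"
  shows "(tree_of u, tree_of v) \<in> (arcs_ends rotation_graph \<union> Id) ^^ n \<and> distinct v \<and> set v = verts G"
  using assms(1)
proof (induction n arbitrary: v)
  case (Suc n)
  then obtain w where w: "(u, w) \<in> swaps ^^ n" "(w, v) \<in> swaps" by auto
  note IH = Suc.IH[OF w(1)]
  have v: "distinct v" "set v = verts G" using IH swaps_set[OF w(2)] by auto
  have "search_tree G (tree_of w)" "search_tree G (tree_of v)" using IH v search_tree_iff by blast+
  moreover have "tree_of w = tree_of v \<or> rotation (tree_of w) (tree_of v)"
  proof -
    obtain us x y vs where wv: "w = us @ x # y # vs" "v = us @ y # x # vs"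
      using w(2) unfolding swaps_def by blast
    have "distinct (us @ x # y # vs)" "mixed (set (us @ x # y # vs))"
      using IH mixed_verts unfolding wv(1) by metis+
    then show ?thesis unfolding wv by (rule swap_rotation)
  qed
  ultimately have "(tree_of w, tree_of v) \<in> arcs_ends rotation_graph \<union> Id"
    unfolding ends_rotation_graph by blast
  then show ?case using IH v by auto
qed (use assms in auto)

lemma length_filter_part:
  assumes "distinct w" "set w = verts G" "X \<subseteq> verts G"
  shows "length (filter (\<lambda>x. x \<in> X) w) = card X" "set (filter (\<lambda>x. x \<in> X) w) = X"
proof -
  show *: "set (filter (\<lambda>x. x \<in> X) w) = X" using assms by auto
  show "length (filter (\<lambda>x. x \<in> X) w) = card X"
    using distinct_card[of "filter (\<lambda>x. x \<in> X) w"] assms(1) unfolding * by simp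
qed

text \<open>
  Route from \<open>w\<close> to \<open>w'\<close>: gather \<open>Y\<close> on top, so that the vertices of \<open>X\<close> become unordered leaves;
  then move \<open>X\<close> to the top in the order it has in \<open>w'\<close>, which makes the vertices of \<open>Y\<close> unordered
  leaves; then insert \<open>Y\<close> where \<open>w'\<close> wants it.
\<close>

lemma rotations_via_gathering:
  assumes XY: "X = A \<and> Y = B \<or> X = B \<and> Y = A"
    and w: "distinct w" "set w = verts G" and w': "distinct w'" "set w' = verts G"
    and le: "pair_count X Y w \<le> pair_count X Y w'"
  shows "\<exists>n \<le> 2 * (card A * card B). (tree_of w, tree_of w') \<in> (arcs_ends rotation_graph \<union> Id) ^^ n"
proof -
  let ?R = "arcs_ends rotation_graph \<union> Id"
  let ?x = "filter (\<lambda>x. x \<in> X) w" and ?y = "filter (\<lambda>y. y \<in> Y) w"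
  let ?x' = "filter (\<lambda>x. x \<in> X) w'" and ?y' = "filter (\<lambda>y. y \<in> Y) w'"
  have disj: "X \<inter> Y = {}" "Y \<inter> X = {}" and V: "verts G = X \<union> Y"
    using XY disjoint verts_eq by auto
  have nm: "\<not> mixed X" "\<not> mixed Y" using XY disjoint by (auto simp: mixed_def)
  have x: "length ?x = card X" "set ?x = X" "length ?x' = card X" "set ?x' = X"
    "length ?y = card Y" "set ?y = Y" "length ?y' = card Y" "set ?y' = Y"
    using length_filter_part[OF w, of X] length_filter_part[OF w', of X]
      length_filter_part[OF w, of Y] length_filter_part[OF w', of Y] unfolding V by auto
  have mx: "mixed (Y \<union> X)" "mixed (X \<union> Y)" using mixed_verts V by (auto simp: Un_commute)
  have "(w, ?y @ ?x) \<in> swaps ^^ pair_count X Y w"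
    by (rule swaps_gather) (use disj w V in auto)
  from swaps_rotations[OF this w]
  have 1: "(tree_of w, tree_of (?y @ ?x)) \<in> ?R ^^ pair_count X Y w" ..
  have 2: "tree_of (?y @ ?x) = tree_of (?y @ ?x')" by (rule tree_of_append_cong) (use x mx nm in auto)
  have d: "distinct (?y @ ?x')" "set (?y @ ?x') = verts G"
    using w w' x disj V by auto
  have "filter (\<lambda>x. x \<in> X) (?y @ ?x') = ?x'" "filter (\<lambda>y. y \<in> Y) (?y @ ?x') = ?y"
    using disj by (auto simp: filter_empty_conv)
  moreover have "pair_count Y X (?y @ ?x') = card A * card B"
    using pair_count_append[of Y X ?y ?x'] disj x XY by auto
  moreover have "set (?y @ ?x') \<subseteq> Y \<union> X" unfolding d(2) V by auto
  ultimately have "(?y @ ?x', ?x' @ ?y) \<in> swaps ^^ (card A * card B)"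
    using swaps_gather[OF disj(2), of "?y @ ?x'"] by metis
  from swaps_rotations[OF this d]
  have 3: "(tree_of (?y @ ?x'), tree_of (?x' @ ?y)) \<in> ?R ^^ (card A * card B)" ..
  have 4: "tree_of (?x' @ ?y) = tree_of (?x' @ ?y')" by (rule tree_of_append_cong) (use x mx nm in auto)
  have "(w', ?x' @ ?y') \<in> swaps ^^ pair_count Y X w'"
    by (rule swaps_gather) (use disj w' V in auto)
  then have ret: "(?x' @ ?y', w') \<in> swaps ^^ pair_count Y X w'" by (rule swaps_relpow_sym)
  have d': "distinct (?x' @ ?y')" "set (?x' @ ?y') = verts G"
    using w' x disj V by auto
  from swaps_rotations[OF ret d']
  have 5: "(tree_of (?x' @ ?y'), tree_of w') \<in> ?R ^^ pair_count Y X w'" ..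
  have "(tree_of w, tree_of w') \<in> ?R ^^ (pair_count X Y w + card A * card B + pair_count Y X w')"
    using 1[unfolded 2] 3[unfolded 4] 5 unfolding relpow_add by (blast intro: relcompI)
  \<comment> \<open>By \<open>le\<close>, gathering \<open>Y\<close> in \<open>w\<close> costs at
    most \<open>pair_count X Y w'\<close>; together with the cost of the last stage this gives one
    further \<open>card A * card B\<close>.\<close>
  moreover have "pair_count X Y w' + pair_count Y X w' = card A * card B"
    using pair_count_add[of X Y w'] disj x XY by auto
  then have "pair_count X Y w + card A * card B + pair_count Y X w' \<le> 2 * (card A * card B)"
    using le by linarith
  ultimately show ?thesis by blast
qed

lemma distance_upper:
  assumes "search_tree G S" "search_tree G T"
  shows "graph_distance rotation_graph S T \<le> ereal (real (2 * (card A * card B)))"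
proof -
  interpret R: wf_digraph rotation_graph by (rule wf_rotation_graph)
  obtain w w' where w: "distinct w" "set w = verts G" "S = tree_of w"
    "distinct w'" "set w' = verts G" "T = tree_of w'"
    using assms search_tree_iff by metis
  have tot: "pair_count A B v + pair_count B A v = card A * card B"
    if "distinct v" "set v = verts G" for v
    using pair_count_add[OF disjoint, of v] length_filter_part[OF that, of A]
      length_filter_part[OF that, of B] by (simp add: verts_eq)
  \<comment> \<open>For both orderings the two counts have the same sum, so if one inequality fails,
    the other holds. This decides which part plays the role of \<open>X\<close>.\<close>
  have "pair_count A B w \<le> pair_count A B w' \<or> pair_count B A w \<le> pair_count B A w'"
    using tot[of w] tot[of w'] w by linarith
  then obtain n where n: "n \<le> 2 * (card A * card B)"
    "(S, T) \<in> (arcs_ends rotation_graph \<union> Id) ^^ n"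
    using rotations_via_gathering[of A B w w'] rotations_via_gathering[of B A w w'] w by blast
  have "graph_distance rotation_graph S T \<le> ereal (real n)"
    using R.graph_distance_le[OF _ n(2)] assms(1) verts_rotation_graph by blast
  also have "\<dots> \<le> ereal (real (2 * (card A * card B)))"
    using n(1) by (simp only: ereal_less_eq of_nat_le_iff)
  finally show ?thesis .
qed

section \<open>The lower bound\<close>

lemma rotation_path_lower:
  assumes bs: "distinct bs" "set bs = B" and as: "distinct as" "set as = A"
    and large: "4 * card A + 1 \<le> card B"
    and path: "(tree_of (bs @ as), tree_of (rev bs @ as)) \<in> arcs_ends rotation_graph ^^ n"
  shows "2 * (card A * card B) \<le> n"
proof -
  obtain F where F: "F 0 = tree_of (bs @ as)" "F n = tree_of (rev bs @ as)"
    "\<And>i. i < n \<Longrightarrow> (F i, F (Suc i)) \<in> arcs_ends rotation_graph"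
    using path unfolding relpow_fun_conv by blast
  have dist: "distinct (bs @ as)" "distinct (rev bs @ as)"
    and sets: "set (bs @ as) = verts G" "set (rev bs @ as) = verts G"
    using bs as disjoint verts_eq by auto
  have "\<exists>w. distinct w \<and> set w = verts G \<and> F i = tree_of w" if "i \<le> n" for i
  proof (cases "i = n")
    case True
    then show ?thesis using F(2) dist sets by blast
  next
    case False
    then have "search_tree G (F i)" using that F(3)[of i] unfolding ends_rotation_graph by auto
    then show ?thesis by (simp add: search_tree_iff)
  qed
  then obtain w' where w': "\<And>i. i \<le> n \<Longrightarrow> distinct (w' i) \<and> set (w' i) = verts G \<and> F i = tree_of (w' i)"
    by metis
  define D where "D i = ancestry (w' i)" for i
  have tubes_of_F: "tubes (F i) = tubes_of (w' i)" if "i \<le> n" for i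
    using w'[OF that] tubes_tree_of mixed_verts by metis
  have ancestry_tubes: "ancestry u = ancestry v"
    if "distinct u" "distinct v" "set u = verts G" "set v = verts G" "tree_of u = tree_of v" for u v
  proof -
    have "tubes_of u = tubes_of v" using that tubes_tree_of mixed_verts by metis
    then show ?thesis using that ancestry_cong by metis
  qed
  \<comment> \<open>The chosen ordering \<open>w' 0\<close> may list the leaves differently from
    \<open>bs @ as\<close>; ancestry does not see this.\<close>
  have D0: "D 0 = ancestry (bs @ as)" unfolding D_def
    by (rule ancestry_tubes) (use w'[of 0] F(1) dist sets in auto)
  have Dn: "D n = ancestry (rev bs @ as)" unfolding D_def
    by (rule ancestry_tubes) (use w'[of n] F(2) dist sets in auto)
  have asym: "(x, y) \<in> D i \<Longrightarrow> (y, x) \<notin> D i" if "i \<le> n" for i x y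
    using ancestry_asym w'[OF that] unfolding D_def by blast
  have comp: "(a, b) \<in> D i \<or> (b, a) \<in> D i" if "i \<le> n" "a \<in> A" "b \<in> B" for i a b
    using ancestry_comparable[of a b "w' i"] w'[OF that(1)] that verts_eq unfolding D_def by auto
  have incomp: "(a, b) \<in> D i"
    if "i \<le> n" "a \<in> A" "b \<in> B" "b' \<in> B" "b \<noteq> b'" "(b, b') \<notin> D i" "(b', b) \<notin> D i" for i a b b'
    using ancestry_incomparable[of b b' a "w' i"] w'[OF that(1)] that verts_eq unfolding D_def by auto
  \<comment> \<open>Ordered pairs, so that exchanges of \<open>a\<close> and \<open>b\<close> in the
    two directions count separately.\<close>
  define P where "P = {(x, y). \<exists>i < n. (x, y) \<in> D i \<and> (y, x) \<in> D (Suc i)}"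
  have flip: "(x, y) \<in> P"
    if "\<And>k. k \<le> n \<Longrightarrow> (x, y) \<in> D k \<or> (y, x) \<in> D k"
      "i \<le> j" "j \<le> n" "(x, y) \<in> D i" "(y, x) \<in> D j" for x y i j
    unfolding P_def mem_Collect_eq prod.case
    using that(1) asym by (rule flip_exists[OF _ _ that(2-5)])
  have uniq: "e = e'" if "i < n" "e \<in> D i" "prod.swap e \<in> D (Suc i)"
    "e' \<in> D i" "prod.swap e' \<in> D (Suc i)" for i e e'
  proof -
    have "card ((tubes (F i) - tubes (F (Suc i))) \<union> (tubes (F (Suc i)) - tubes (F i))) = 2"
      using F(3)[OF that(1)] unfolding ends_rotation_graph rotation_def by blast
    then show ?thesis
      using flip_unique[of "w' i" "w' (Suc i)" "fst e" "snd e" "fst e'" "snd e'"]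
        w'[of i] w'[of "Suc i"] tubes_of_F[of i] tubes_of_F[of "Suc i"] that
      unfolding D_def by (cases e, cases e') simp
  qed
  \<comment> \<open>A rotation reverses at most one ordered pair, by \<open>uniq\<close>. So
    choosing a time of reversal for each member of \<open>P\<close> is injective, and
    \<open>card P\<close> bounds the length of the path from below.\<close>
  define step where "step e = (SOME i. i < n \<and> e \<in> D i \<and> prod.swap e \<in> D (Suc i))" for e
  have step: "step e < n \<and> e \<in> D (step e) \<and> prod.swap e \<in> D (Suc (step e))" if "e \<in> P" for e
    unfolding step_def by (rule someI_ex) (use that in \<open>auto simp: P_def\<close>)
  have inj: "inj_on step P"
    by (rule inj_onI) (metis step uniq)
  have "finite P" using inj step by (intro inj_on_finite[of step P "{..<n}"]) auto
  have "card P \<le> card {..<n}" using inj step by (intro card_inj_on_le[of step]) auto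
  then have P_le: "card P \<le> n" by simp
  have as_ne: "as \<noteq> []" using as nonempty by auto
  have fin: "finite A" "finite B" using as bs by auto
  define S where "S = {b \<in> B. \<exists>i \<le> n. \<forall>a \<in> A. (a, b) \<in> D i}"
  have S: "S \<subseteq> B" by (auto simp: S_def)
  have top: "(b, a) \<in> D 0" "(b, a) \<in> D n" if "a \<in> A" "b \<in> B" for a b
    using ancestry_append(1)[of bs as b a] ancestry_append(1)[of "rev bs" as b a] dist as_ne bs as that
    unfolding D0 Dn by auto
  \<comment> \<open>At both ends \<open>b\<close> is above \<open>a\<close>, at time
    \<open>i\<close> below it, so both directions of exchange occur.\<close>
  have P1: "(b, a) \<in> P" "(a, b) \<in> P" if ab: "b \<in> S" "a \<in> A" for a b
  proof -
    obtain i where i: "i \<le> n" "(a, b) \<in> D i" using ab by (auto simp: S_def)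
    have b: "b \<in> B" using ab S by blast
    have c: "(a, b) \<in> D k \<or> (b, a) \<in> D k" if "k \<le> n" for k using comp[OF that ab(2) b] .
    show "(b, a) \<in> P"
      by (rule flip[of b a 0 i]) (use c i top(1)[OF ab(2) b] in auto)
    show "(a, b) \<in> P"
      by (rule flip[of a b i n]) (use c i top(2)[OF ab(2) b] in auto)
  qed
  let ?q = "length bs"
  have P2: "(bs ! i, bs ! j) \<in> P" if ij: "i < j" "j < ?q" "\<not> (bs ! i \<in> S \<and> bs ! j \<in> S)" for i j
  proof -
    let ?b = "bs ! i" and ?c = "bs ! j"
    have bc: "?b \<in> B" "?c \<in> B" "?b \<noteq> ?c" using ij bs nth_eq_iff_index_eq[of bs i j] by auto
    have "(?b, ?c) \<in> D 0" unfolding D0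
      by (rule ancestry_append(2)) (use dist as as_ne bs ij in auto)
    moreover have "(?c, ?b) \<in> D n"
    proof -
      \<comment> \<open>Reversing the list turns the positions \<open>i < j\<close> into
        \<open>?q - Suc j < ?q - Suc i\<close>.\<close>
      have "(rev bs ! (?q - Suc j), rev bs ! (?q - Suc i)) \<in> D n" unfolding Dn
        by (rule ancestry_append(2)) (use dist as as_ne bs ij in auto)
      then show ?thesis using ij by (simp add: rev_nth)
    qed
    \<comment> \<open>If the two were incomparable at time \<open>k\<close>, both would then lie
      below all of \<open>A\<close>, so both would belong to \<open>S\<close>.\<close>
    moreover have "(?b, ?c) \<in> D k \<or> (?c, ?b) \<in> D k" if "k \<le> n" for k
    proof (rule ccontr)
      assume "\<not> ?thesis"
      then have "\<forall>a \<in> A. (a, ?b) \<in> D k" "\<forall>a \<in> A. (a, ?c) \<in> D k"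
        using incomp that bc by metis+
      then show False using that bc ij(3) unfolding S_def by blast
    qed
    ultimately show ?thesis using flip[of ?b ?c 0 n] by simp
  qed
  define I where "I = {i. i < ?q \<and> bs ! i \<in> S}"
  \<comment> \<open>Pairs of \<open>B\<close> are counted through their positions in
    \<open>bs\<close>, one direction each; \<open>L {..<?q} - L I\<close> indexes the pairs not both
    in \<open>S\<close>.\<close>
  define L where "L J = {(i, j). i \<in> J \<and> j \<in> J \<and> i < j}" for J :: "nat set"
  have finL: "finite (L J)" if "finite J" for J
    by (rule finite_subset[of _ "J \<times> J"]) (use that in \<open>auto simp: L_def\<close>)
  have finI: "finite I" "I \<subseteq> {..<?q}" by (auto simp: I_def)
  have LI: "L I \<subseteq> L {..<?q}" using finI by (auto simp: L_def)
  let ?nth = "\<lambda>(i, j). (bs ! i, bs ! j)"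
  let ?Q = "?nth ` (L {..<?q} - L I)"
  have inj_bs: "inj_on (\<lambda>i. bs ! i) {..<?q}" using bs by (auto simp: inj_on_def nth_eq_iff_index_eq)
  have cardQ: "card ?Q = card (L {..<?q}) - card (L I)"
  proof -
    have "inj_on ?nth ({..<?q} \<times> {..<?q})" using inj_bs by (auto simp: inj_on_def)
    then have "inj_on ?nth (L {..<?q} - L I)" by (rule inj_on_subset) (auto simp: L_def)
    then have "card ?Q = card (L {..<?q} - L I)" by (rule card_image)
    also have "\<dots> = card (L {..<?q}) - card (L I)" using LI finL finI by (intro card_Diff_subset) auto
    finally show ?thesis .
  qed
  have cardI: "card I = card S"
  proof -
    have "(\<lambda>i. bs ! i) ` I = S" using S bs
      by (auto simp: I_def in_set_conv_nth image_iff) (metis in_set_conv_nth subsetD)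
    moreover have "inj_on (\<lambda>i. bs ! i) I" using inj_bs finI(2) by (rule inj_on_subset)
    ultimately show ?thesis using card_image by metis
  qed
  have q: "?q = card B" using bs distinct_card by metis
  have finS: "finite S" using S fin finite_subset by blast
  have sub: "S \<times> A \<union> A \<times> S \<union> ?Q \<subseteq> P"
  proof -
    have "?Q \<subseteq> P"
    proof clarsimp
      fix i j assume "(i, j) \<in> L {..<?q}" "(i, j) \<notin> L I"
      then show "(bs ! i, bs ! j) \<in> P" by (intro P2) (auto simp: L_def I_def)
    qed
    moreover have "S \<times> A \<union> A \<times> S \<subseteq> P" using P1 by blast
    ultimately show ?thesis by blast
  qed
  have "?Q \<subseteq> B \<times> B" using bs by (auto simp: L_def)
  then have d: "(S \<times> A \<union> A \<times> S) \<inter> ?Q = {}" "S \<times> A \<inter> A \<times> S = {}" using disjoint S by blast+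
  have "card (S \<times> A \<union> A \<times> S \<union> ?Q) = card (S \<times> A) + card (A \<times> S) + card ?Q"
    using d finS fin finL by (simp add: card_Un_disjoint)
  then have "2 * (card S * card A) + card ?Q \<le> card P"
    using card_mono[OF \<open>finite P\<close> sub] by (simp add: card_cartesian_product mult.commute)
  then have main: "2 * (card S * card A) + (card (L {..<?q}) - card (L I)) \<le> n"
    using P_le unfolding cardQ by linarith
  have LLe: "card (L I) \<le> card (L {..<?q})" using LI finL by (intro card_mono) auto
  have c1: "2 * card (L {..<?q}) + card B = card B * card B"
    using card_less_pairs[of "{..<?q}"] q unfolding L_def by simp
  have c2: "2 * card (L I) + card S = card S * card S"
    using card_less_pairs[of I] finI(1) cardI unfolding L_def by simp
  have s_le: "card S \<le> card B" using S fin card_mono by blast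
  \<comment> \<open>With \<open>m\<close> elements outside \<open>S\<close>, twice the number of
    pairs in \<open>?Q\<close> is \<open>m * (card B + card S - 1)\<close>, which is at least
    \<open>m * (card B - 1)\<close> and, by \<open>large\<close>, at least
    \<open>4 * (m * card A)\<close>. So \<open>?Q\<close> makes up for the
    \<open>2 * m * card A\<close> exchanges with \<open>A\<close> that are not guaranteed outside
    \<open>S\<close>.\<close>
  obtain m where m: "card B = card S + m" using s_le le_Suc_ex by blast
  have "4 * (m * card A) + m * 1 \<le> m * card B"
    using large mult_le_mono2[of "4 * card A + 1" "card B" m] by (simp add: algebra_simps)
  moreover have "card B * card B + card S = card S * card S + m * card S + m * card B + card S"
    unfolding m by (simp add: algebra_simps)
  ultimately have "4 * (m * card A) \<le> 2 * (card (L {..<?q}) - card (L I))"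
    using c1 c2 LLe m by linarith
  moreover have "card A * card B = card S * card A + m * card A" unfolding m by (simp add: algebra_simps)
  ultimately show ?thesis using main by linarith
qed

section \<open>The diameter from the two bounds\<close>

lemma associahedron_diameter_eq:
  assumes "4 * card A + 1 \<le> card B"
  shows "associahedron_diameter G = ereal (real (2 * (card A * card B)))"
proof -
  interpret R: wf_digraph rotation_graph by (rule wf_rotation_graph)
  have fin: "finite A" "finite B" using finite_verts unfolding verts_eq by auto
  obtain as bs where l: "distinct as" "set as = A" "distinct bs" "set bs = B"
    using fin finite_distinct_list by metis
  have t: "search_tree G (tree_of (bs @ as))" "search_tree G (tree_of (rev bs @ as))"
    unfolding search_tree_iff using l disjoint verts_eq
    by (intro exI conjI refl; auto)+
  show ?thesis
    unfolding associahedron_diameter_def graph_diameter_def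
  proof (rule antisym)
    show "(SUP u \<in> verts rotation_graph. SUP v \<in> verts rotation_graph.
        graph_distance rotation_graph u v) \<le> ereal (real (2 * (card A * card B)))"
      using distance_upper unfolding verts_rotation_graph by (intro SUP_least) auto
    have "ereal (real (2 * (card A * card B)))
        \<le> graph_distance rotation_graph (tree_of (bs @ as)) (tree_of (rev bs @ as))"
      using rotation_path_lower l assms by (intro R.graph_distance_ge) blast
    then show "ereal (real (2 * (card A * card B))) \<le> (SUP u \<in> verts rotation_graph.
        SUP v \<in> verts rotation_graph. graph_distance rotation_graph u v)"
      using t unfolding verts_rotation_graph by (intro SUP_upper2) auto
  qed
qed

end

theorem theorem9:
  fixes p q :: nat and G :: "('a, 'b) pre_digraph"
  assumes "p \<ge> 1" and "q \<ge> 1" and "q \<ge> 4 * p + 1"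
    and "complete_bipartite_digraph p q G"
  shows "associahedron_diameter G = ereal (real (2 * p * q))"
proof -
  obtain U V where UV: "verts G = U \<union> V" "U \<inter> V = {}" "card U = p" "card V = q"
    "arcs_ends G = U \<times> V \<union> V \<times> U" and "graph G"
    using assms(4) unfolding complete_bipartite_digraph_def by blast
  interpret graph G by fact
  interpret complete_bipartite G U V
    by unfold_locales (use UV assms(1,2) in auto)
  show ?thesis using associahedron_diameter_eq UV assms(3) by (simp add: mult.assoc)
qed

end
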